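(* Let $(L,\mathcal G)$ be a nestoid and $N$ a maximal nested set. The cone dual to $U_N$ (viewed as a full-dimensional cone in the hyperplane $m_{\hat 1}=0$ of $\mathbb R^{2N}$) is the cone over the cosmological polytope of $T_N$ under a linear isomorphism. The isomorphism is given by $$(\mathbb R^{2N})^\vee/\langle m_{\hat 1}\rangle\to\mathbb R^{E(T_N)\cup V(T_N)},\qquad p_{\hat 1}\mapsto 2\mathbf x_{\hat 1},\quad p_g\mapsto\mathbf x_g+\mathbf y_g-\mathbf x_f,\quad m_g\mapsto\mathbf x_f+\mathbf y_g-\mathbf x_g,$$ where $g\in N$, $g<\hat 1$, and $f$ is the unique element covering $g$ in $N$.
   Context: All lattices are finite. Let $L$ be a lattice with minimum $\hat 0$ and maximum $\hat 1$. A subset $\mathcal G\subseteq L_{>\hat 0}$ is nestable if $\hat 1\in\mathcal G$ and for any two incomparable $f,g\in\mathcal G$, $f\vee g\notin\mathcal G$ implies $f\wedge g=\hat 0$. A subset $N\subseteq\mathcal G$ is nested if for all $k\ge 2$ and pairwise incomparable $f_1,\dots,f_k\in N$ one has $f_1\vee\dots\vee f_k\notin\mathcal G$. $\mathcal N(L,\mathcal G)$ is the simplicial complex of nested sets. $(L,\mathcal G)$ is a nestoid if $\mathcal G$ is nestable and for every $f\in\mathcal G$ the complex $\mathcal N([\hat 0,f],\mathcal G\cap[\hat 0,f])$ is pure. Maximal nested sets contain $\hat 1$. For a nested set $N$, $\mathbb R^{2N}$ is the real vector space with basis $f^+,f^-$ ($f\in N$), with dual basis $p_f,m_f$. For a maximal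 nested set $N$, $U_N\subseteq\mathbb R^{2N}$ is the cone cut out by $m_{\hat 1}=0$ and $p_g\ge0$, $m_g\ge0$, $F_g\ge0$ for $g\in N$, where $F_g:=p_{\hat 1}+\sum_{f\in N,\ g<f<\hat 1}(p_f-m_f)-m_g$. The Hasse diagram of $N$ is a rooted tree $T_N$ with vertex set $V(T_N)=N$ and root $\hat 1$; its edges, forming the set $E(T_N)$, are labelled by the elements $f\in N$, $f\neq\hat 1$ (the edge joining $f$ to the unique element covering it). $\mathbb R^{E(T_N)\cup V(T_N)}$ has basis $\mathbf x_f$ ($f\in N$) and $\mathbf y_f$ ($f\in N$, $f\ne\hat 1$). The cosmological polytope of $T_N$ is the convex hull of the vectors $$\mathbf x_f+\mathbf x_g-\mathbf y_f,\qquad \mathbf x_f-\mathbf x_g+\mathbf y_f,\qquad -\mathbf x_f+\mathbf x_g+\mathbf y_f$$ over all edges $f<g$ of $T_N$ ($g$ covering $f$).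
   Formalization: If N consists only of the maximum, the tree has no edges and the cosmological polytope as defined is empty while the dual cone is a ray, so the claim fails; there the polytope is replaced by the single point x at the maximum. *)

theory Defs
  imports "HOL-Analysis.Analysis"
begin

section \<open>Nested sets and nestoids\<close>

text \<open>A finite lattice is a type of sort \<open>{finite, bounded_lattice}\<close>, with minimum \<open>bot\<close> and
  maximum \<open>top\<close>.\<close>

definition incomparable :: "'a::order \<Rightarrow> 'a \<Rightarrow> bool" where
  "incomparable f g \<longleftrightarrow> \<not> f \<le> g \<and> \<not> g \<le> f"

definition nestable :: "'a::{finite, bounded_lattice} set \<Rightarrow> bool" where
  "nestable G \<longleftrightarrow> G \<subseteq> {bot<..} \<and> top \<in> G \<and>
     (\<forall>f\<in>G. \<forall>g\<in>G. incomparable f g \<longrightarrow> sup f g \<notin> G \<longrightarrow> inf f g = bot)"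

definition nested :: "'a::{finite, bounded_lattice} set \<Rightarrow> 'a set \<Rightarrow> bool" where
  "nested G N \<longleftrightarrow> N \<subseteq> G \<and>
     (\<forall>A \<subseteq> N. 2 \<le> card A \<and> pairwise incomparable A \<longrightarrow> Sup_fin A \<notin> G)"

definition nested_complex :: "'a::{finite, bounded_lattice} set \<Rightarrow> 'a set set" where
  "nested_complex G = {N. nested G N}"

definition facet :: "'a set set \<Rightarrow> 'a set \<Rightarrow> bool" where
  "facet K A \<longleftrightarrow> A \<in> K \<and> (\<forall>B\<in>K. A \<subseteq> B \<longrightarrow> B = A)"

definition pure :: "'a set set \<Rightarrow> bool" where
  "pure K \<longleftrightarrow> (\<forall>A B. facet K A \<and> facet K B \<longrightarrow> card A = card B)"

text \<open>Joins in an interval \<open>{bot..f}\<close> agree with joins in the whole lattice, so the nested complex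
  of the lattice \<open>{bot..f}\<close> with respect to \<open>G \<inter> {bot..f}\<close> is \<open>nested_complex (G \<inter> {bot..f})\<close>.\<close>

definition nestoid :: "'a::{finite, bounded_lattice} set \<Rightarrow> bool" where
  "nestoid G \<longleftrightarrow> nestable G \<and> (\<forall>f\<in>G. pure (nested_complex (G \<inter> {bot..f})))"

definition maximal_nested :: "'a::{finite, bounded_lattice} set \<Rightarrow> 'a set \<Rightarrow> bool" where
  "maximal_nested G N \<longleftrightarrow> facet (nested_complex G) N"


section \<open>Coordinate spaces, duals and quotients\<close>

text \<open>For a set \<open>I\<close> of indices, the space of real vectors indexed by \<open>I\<close> is the subspace of
  \<open>real ^ 'i\<close> of vectors supported on \<open>I\<close>.  A linear functional on it is represented by its
  extension by zero on the basis vectors outside \<open>I\<close>; this identifies the dual of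
  \<open>coord_space I\<close> with the subspace \<open>dual_space I\<close> of the dual of \<open>real ^ 'i\<close>.\<close>

definition coord_space :: "'i::finite set \<Rightarrow> (real ^ 'i) set" where
  "coord_space I = {v. \<forall>i. i \<notin> I \<longrightarrow> v $ i = 0}"

definition dual_space :: "'i::finite set \<Rightarrow> ((real ^ 'i) \<Rightarrow>\<^sub>L real) set" where
  "dual_space I = {\<phi>. \<forall>i. i \<notin> I \<longrightarrow> blinfun_apply \<phi> (axis i 1) = 0}"

definition coset :: "'v::real_vector set \<Rightarrow> 'v \<Rightarrow> 'v set" where
  "coset U \<phi> = (+) \<phi> ` U"

definition quotient_space :: "'v::real_vector set \<Rightarrow> 'v set \<Rightarrow> 'v set set" where
  "quotient_space V U = coset U ` V"

text \<open>Linear isomorphisms from \<open>quotient_space V U\<close> onto \<open>W\<close>; the vector space operations on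
  cosets are those on representatives.\<close>

definition linear_iso_quotient ::
    "'v::real_vector set \<Rightarrow> 'v set \<Rightarrow> 'w::real_vector set \<Rightarrow> ('v set \<Rightarrow> 'w) \<Rightarrow> bool" where
  "linear_iso_quotient V U W \<Psi> \<longleftrightarrow>
     bij_betw \<Psi> (quotient_space V U) W \<and>
     (\<forall>\<phi>\<in>V. \<forall>\<psi>\<in>V. \<Psi> (coset U (\<phi> + \<psi>)) = \<Psi> (coset U \<phi>) + \<Psi> (coset U \<psi>)) \<and>
     (\<forall>c. \<forall>\<phi>\<in>V. \<Psi> (coset U (c *\<^sub>R \<phi>)) = c *\<^sub>R \<Psi> (coset U \<phi>))"


section \<open>The cone of a nested set and its dual\<close>

text \<open>The basis vectors \<open>f\<^sup>+\<close> and \<open>f\<^sup>-\<close> of the space attached to \<open>N\<close> are indexed by \<open>Inl f\<close> and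
  \<open>Inr f\<close>, so that this space is \<open>coord_space (N <+> N)\<close>; \<open>p_fun f\<close> and \<open>m_fun f\<close> form the dual
  basis.\<close>

definition p_fun :: "'a::finite \<Rightarrow> (real ^ ('a + 'a)) \<Rightarrow>\<^sub>L real" where
  "p_fun f = blinfun_inner_right (axis (Inl f) 1)"

definition m_fun :: "'a::finite \<Rightarrow> (real ^ ('a + 'a)) \<Rightarrow>\<^sub>L real" where
  "m_fun f = blinfun_inner_right (axis (Inr f) 1)"

definition F_fun ::
    "'a::{finite, bounded_lattice} set \<Rightarrow> 'a \<Rightarrow> (real ^ ('a + 'a)) \<Rightarrow>\<^sub>L real" where
  "F_fun N g = p_fun top + (\<Sum>f\<in>{f \<in> N. g < f \<and> f < top}. p_fun f - m_fun f) - m_fun g"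

definition hyperplane_N :: "'a::{finite, bounded_lattice} set \<Rightarrow> (real ^ ('a + 'a)) set" where
  "hyperplane_N N = {v \<in> coord_space (N <+> N). blinfun_apply (m_fun top) v = 0}"

definition cone_U :: "'a::{finite, bounded_lattice} set \<Rightarrow> (real ^ ('a + 'a)) set" where
  "cone_U N = {v \<in> hyperplane_N N. \<forall>g\<in>N.
     0 \<le> blinfun_apply (p_fun g) v \<and> 0 \<le> blinfun_apply (m_fun g) v \<and>
     0 \<le> blinfun_apply (F_fun N g) v}"

text \<open>The quotient of \<open>dual_space (N <+> N)\<close> by \<open>span {m_fun top}\<close> is the dual of
  \<open>hyperplane_N N\<close>: a coset is evaluated on the hyperplane through any of its representatives.
  The dual cone of \<open>cone_U N\<close>, as a cone in the hyperplane, therefore lives in this quotient.\<close>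

definition dual_cone_U ::
    "'a::{finite, bounded_lattice} set \<Rightarrow> ((real ^ ('a + 'a)) \<Rightarrow>\<^sub>L real) set set" where
  "dual_cone_U N = {coset (span {m_fun top}) \<phi> | \<phi>.
     \<phi> \<in> dual_space (N <+> N) \<and> (\<forall>v \<in> cone_U N. 0 \<le> blinfun_apply \<phi> v)}"


section \<open>The tree of a nested set and its cosmological polytope\<close>

definition covered_by :: "'a::order set \<Rightarrow> 'a \<Rightarrow> 'a \<Rightarrow> bool" where
  "covered_by N f g \<longleftrightarrow> f \<in> N \<and> g \<in> N \<and> f < g \<and> \<not> (\<exists>h\<in>N. f < h \<and> h < g)"

text \<open>The edge from \<open>f\<close> to the element covering it is labelled by \<open>f\<close>.  The space with basis
  \<open>x_vec f\<close> (for \<open>f \<in> N\<close>) and \<open>y_vec f\<close> (for \<open>f \<in> N - {top}\<close>) is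
  \<open>coord_space (N <+> (N - {top}))\<close>.\<close>

definition x_vec :: "'a::finite \<Rightarrow> real ^ ('a + 'a)" where
  "x_vec f = axis (Inl f) 1"

definition y_vec :: "'a::finite \<Rightarrow> real ^ ('a + 'a)" where
  "y_vec f = axis (Inr f) 1"

text \<open>If \<open>N = {top}\<close> the tree has no edges and this convex hull is empty, whereas the dual cone
  of \<open>cone_U N\<close> is a ray; there the single point \<open>x_vec top\<close> takes the role of the polytope, and
  the two cases are kept apart wherever the cone over the polytope is used.\<close>

definition cosmological_polytope ::
    "'a::{finite, bounded_lattice} set \<Rightarrow> (real ^ ('a + 'a)) set" where
  "cosmological_polytope N = convex hull
     (\<Union>(f, g) \<in> {(f, g). covered_by N f g}.
        {x_vec f + x_vec g - y_vec f, x_vec f - x_vec g + y_vec f, - x_vec f + x_vec g + y_vec f})"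

end

theory Submission
  imports Defs
begin

text \<open>
  In a nested set two elements with a common lower bound other than \<open>bot\<close> are comparable:
  otherwise their join would lie outside \<open>G\<close>, and nestability would force their meet to be
  \<open>bot\<close>.  As a maximal nested set also contains \<open>top\<close>, its Hasse diagram is a tree in which every
  \<open>g < top\<close> has a unique cover \<open>cover g\<close>, and the elements of \<open>N\<close> above \<open>g\<close> form the path from
  \<open>cover g\<close> to \<open>top\<close>.  This tree structure (locale \<open>nested_tree\<close>) is the only combinatorial input.

  The prescribed map sends \<open>p_fun g - m_fun g\<close> to \<open>2 (x_vec g - x_vec (cover g))\<close> and
  \<open>p_fun g + m_fun g\<close> to \<open>2 y_vec g\<close>.  Summing the differences along the path from \<open>g\<close> to the
  root and adding \<open>p_fun top\<close>, which maps to \<open>2 x_vec top\<close>, gives a telescoping sum with image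
  \<open>2 x_vec g\<close>.  This produces an explicit inverse modulo \<open>m_fun top\<close> (\<open>from_tree\<close>).  The same
  telescoping evaluates the remaining inequalities: \<open>F_fun N g\<close> goes to
  \<open>2 x_vec (cover g)\<close> minus the image of \<open>m_fun g\<close>, which is
  \<open>x_vec g + x_vec (cover g) - y_vec g\<close>.  So the functionals \<open>p_fun g\<close>, \<open>m_fun g\<close> and \<open>F_fun N g\<close>
  correspond exactly to the three vertices of the cosmological polytope attached to the edge \<open>g\<close>.

  By Farkas' lemma the cone dual to \<open>cone_U N\<close> is generated by the functionals defining
  \<open>cone_U N\<close>, so its image is generated by the vertices of the polytope together with
  \<open>2 x_vec top\<close>, the image of \<open>p_fun top\<close> and of \<open>F_fun N top\<close>.  If the tree has an edge, it has an edge
  ending at the root; two of the three vertices attached to that edge add up to \<open>2 x_vec top\<close>,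
  which is therefore redundant.
\<close>

section \<open>Quotients and dual cones\<close>

lemma first_isomorphism:
  assumes T: "linear T" and V: "subspace V" and U: "U = {\<phi> \<in> V. T \<phi> = 0}" and W: "T ` V = W"
  obtains \<Psi> where "linear_iso_quotient V U W \<Psi>" and "\<And>\<phi>. \<phi> \<in> V \<Longrightarrow> \<Psi> (coset U \<phi>) = T \<phi>"
proof -
  define \<Psi> where "\<Psi> C = the_elem (T ` C)" for C
  have "T ` coset U \<phi> = {T \<phi>}" for \<phi>
  proof -
    have "0 \<in> U"
      using U V T by (simp add: subspace_0 linear_0)
    then have "U \<noteq> {}"
      by blast
    moreover have "T (\<phi> + \<psi>) = T \<phi>" if "\<psi> \<in> U" for \<psi>
      using that U T by (simp add: linear_add)
    then have "(\<lambda>\<psi>. T (\<phi> + \<psi>)) ` U = (\<lambda>_. T \<phi>) ` U"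
      by (rule image_cong[OF refl])
    ultimately show ?thesis
      by (simp add: coset_def image_image image_constant_conv)
  qed
  then have eval: "\<Psi> (coset U \<phi>) = T \<phi>" for \<phi>
    by (simp add: \<Psi>_def)
  have "coset U \<phi> = coset U \<psi>" if "T \<phi> = T \<psi>" "\<phi> \<in> V" "\<psi> \<in> V" for \<phi> \<psi>
  proof -
    have sub: "coset U \<alpha> \<subseteq> coset U \<beta>" if "T \<alpha> = T \<beta>" "\<alpha> \<in> V" "\<beta> \<in> V" for \<alpha> \<beta>
    proof
      fix \<gamma> assume "\<gamma> \<in> coset U \<alpha>"
      then obtain u where u: "u \<in> U" "\<gamma> = \<alpha> + u"
        by (auto simp: coset_def)
      then have "\<alpha> - \<beta> + u \<in> U"
        using that U T V by (simp add: linear_add linear_diff subspace_add subspace_diff)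
      moreover have "\<gamma> = \<beta> + (\<alpha> - \<beta> + u)"
        using u by simp
      ultimately show "\<gamma> \<in> coset U \<beta>"
        unfolding coset_def by blast
    qed
    show ?thesis
      using sub[of \<phi> \<psi>] sub[of \<psi> \<phi>] that by auto
  qed
  then have "inj_on \<Psi> (quotient_space V U)"
    unfolding inj_on_def quotient_space_def ball_simps eval by blast
  moreover have "\<Psi> ` quotient_space V U = W"
    using W by (simp add: quotient_space_def image_image eval)
  ultimately have "linear_iso_quotient V U W \<Psi>"
    using T by (simp add: linear_iso_quotient_def bij_betw_def eval linear_add linear_scale)
  then show thesis
    using eval that by blast
qed

text \<open>A finitely generated cone is closed, so a point outside it is strictly separated from it.  The
  separating functional is nonnegative on the cone since the cone is closed under scaling.\<close>

lemma farkas: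
  fixes A :: "'v::euclidean_space set"
  assumes "finite A" and pos: "\<And>v. (\<And>a. a \<in> A \<Longrightarrow> 0 \<le> v \<bullet> a) \<Longrightarrow> 0 \<le> v \<bullet> c"
  shows "c \<in> convex_cone hull A"
proof (rule ccontr)
  let ?K = "convex_cone hull A"
  assume "c \<notin> ?K"
  moreover have "closed ?K"
    using \<open>finite A\<close> by (intro polyhedron_imp_closed polyhedron_convex_cone_hull)
  ultimately obtain v b where c: "v \<bullet> c < b" and K: "\<And>x. x \<in> ?K \<Longrightarrow> b < v \<bullet> x"
    using separating_hyperplane_closed_point[OF convex_convex_cone_hull] by blast
  have b: "b < 0"
    using K[OF convex_cone_hull_contains_0] by simp
  have "0 \<le> v \<bullet> a" if "a \<in> A" for a
  proof (rule ccontr)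
    assume neg: "\<not> 0 \<le> v \<bullet> a"
    \<comment> \<open>This multiple of \<open>a\<close> lies on the separating hyperplane.\<close>
    have "(b / (v \<bullet> a)) *\<^sub>R a \<in> ?K"
      using neg b that by (intro convex_cone_hull_mul hull_inc) (auto simp: divide_nonpos_neg)
    then show False
      using K neg by fastforce
  qed
  then have "0 \<le> v \<bullet> c"
    by (rule pos)
  then show False
    using c b by linarith
qed

lemma convex_cone_hull_eq_cone_hull:
  fixes S :: "'v::real_vector set"
  assumes "S \<noteq> {}"
  shows "convex_cone hull S = cone hull (convex hull S)"
  using assms by (auto simp: convex_cone_hull_convex_hull_nonempty cone_hull_expl)

section \<open>Coordinates\<close>

lemma p_fun_apply: "blinfun_apply (p_fun f) v = v $ Inl f"
  by (simp add: p_fun_def inner_axis')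

lemma m_fun_apply: "blinfun_apply (m_fun f) v = v $ Inr f"
  by (simp add: m_fun_def inner_axis')

lemma F_fun_apply:
  "blinfun_apply (F_fun N g) v =
    v $ Inl top + (\<Sum>f\<in>{f \<in> N. g < f \<and> f < top}. v $ Inl f - v $ Inr f) - v $ Inr g"
  by (simp add: F_fun_def blinfun.add_left blinfun.diff_left blinfun.sum_left
      p_fun_apply m_fun_apply)

lemma p_fun_axis [simp]:
  "blinfun_apply (p_fun f) (axis (Inl g) 1) = (if f = g then 1 else 0)"
  "blinfun_apply (p_fun f) (axis (Inr g) 1) = 0"
  by (simp_all add: p_fun_def inner_axis_axis)

lemma m_fun_axis [simp]:
  "blinfun_apply (m_fun f) (axis (Inl g) 1) = 0"
  "blinfun_apply (m_fun f) (axis (Inr g) 1) = (if f = g then 1 else 0)"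
  by (simp_all add: m_fun_def inner_axis_axis)

lemma subspace_dual_space: "subspace (dual_space I)"
  by (simp add: subspace_def dual_space_def blinfun.add_left blinfun.scaleR_left)

lemma subspace_coord_space: "subspace (coord_space I)"
  by (simp add: subspace_def coord_space_def)

lemma subspace_hyperplane_N: "subspace (hyperplane_N N)"
  by (simp add: subspace_def hyperplane_N_def coord_space_def m_fun_apply)

lemma p_fun_dual [simp]: "g \<in> I \<Longrightarrow> p_fun g \<in> dual_space (I <+> J)"
  by (auto simp: dual_space_def p_fun_def inner_axis_axis)

lemma m_fun_dual [simp]: "g \<in> J \<Longrightarrow> m_fun g \<in> dual_space (I <+> J)"
  by (auto simp: dual_space_def m_fun_def inner_axis_axis)

lemma dual_space_expansion:
  fixes \<phi> :: "(real ^ ('a::finite + 'a)) \<Rightarrow>\<^sub>L real"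
  assumes "\<phi> \<in> dual_space (N <+> N)"
  shows "\<phi> = (\<Sum>g\<in>N. blinfun_apply \<phi> (axis (Inl g) 1) *\<^sub>R p_fun g +
                    blinfun_apply \<phi> (axis (Inr g) 1) *\<^sub>R m_fun g)"
proof (rule blinfun_euclidean_eqI)
  fix i :: "real ^ ('a + 'a)" assume "i \<in> Basis"
  then obtain s where "i = axis s 1"
    by (auto simp: Basis_vec_def)
  then show "blinfun_apply \<phi> i = blinfun_apply (\<Sum>g\<in>N. blinfun_apply \<phi> (axis (Inl g) 1) *\<^sub>R p_fun g +
                    blinfun_apply \<phi> (axis (Inr g) 1) *\<^sub>R m_fun g) i"
    using assms
    by (cases s)
      (auto simp: dual_space_def blinfun.sum_left blinfun.add_left blinfun.scaleR_left
        if_distrib[of "\<lambda>c. _ * c"] cong: if_cong)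
qed

lemma x_vec_coord: "g \<in> I \<Longrightarrow> x_vec g \<in> coord_space (I <+> J)"
  by (auto simp: coord_space_def x_vec_def axis_def)

lemma y_vec_coord: "g \<in> J \<Longrightarrow> y_vec g \<in> coord_space (I <+> J)"
  by (auto simp: coord_space_def y_vec_def axis_def)

lemma coord_space_expansion:
  fixes w :: "real ^ ('a::finite + 'a)"
  assumes "w \<in> coord_space (I <+> J)"
  shows "w = (\<Sum>g\<in>I. (w $ Inl g) *\<^sub>R x_vec g) + (\<Sum>g\<in>J. (w $ Inr g) *\<^sub>R y_vec g)"
    (is "_ = ?s")
proof -
  have "w $ i = ?s $ i" for i
    using assms
    by (cases i) (auto simp: coord_space_def x_vec_def y_vec_def axis_def sum_component
        if_distrib cong: if_cong)
  then show ?thesis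
    unfolding vec_eq_iff by blast
qed

section \<open>The tree of a nested set\<close>

text \<open>The order structure of a maximal nested set: a tree with root \<open>top\<close>, in which the strict upper
  bounds of each vertex form a chain.\<close>

locale nested_tree =
  fixes N :: "'a::{finite, bounded_lattice} set"
  assumes top_in: "top \<in> N"
    and chain_above: "\<lbrakk>f \<in> N; g \<in> N; h \<in> N; h < f; h < g\<rbrakk> \<Longrightarrow> f \<le> g \<or> g \<le> f"
begin

lemma ex1_cover:
  assumes "g \<in> N" and "g < top"
  shows "\<exists>!f. covered_by N g f"
proof -
  let ?A = "{h \<in> N. g < h}"
  have "?A \<noteq> {}"
    using top_in assms by blast
  then obtain f where f: "f \<in> ?A" "\<And>h. h \<in> ?A \<Longrightarrow> h \<le> f \<Longrightarrow> h = f"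
    using finite_has_minimal[of ?A] by auto
  have least: "f \<le> h" if "h \<in> ?A" for h
    using f that chain_above[of f h g] assms by auto
  show ?thesis
  proof (rule ex1I)
    show "covered_by N g f"
      using f assms by (fastforce simp: covered_by_def)
    show "f' = f" if "covered_by N g f'" for f'
      using that least[of f'] f by (auto simp: covered_by_def order_le_less)
  qed
qed

definition cover :: "'a \<Rightarrow> 'a" where
  "cover g = (THE f. covered_by N g f)"

lemma covered_by_cover: "\<lbrakk>g \<in> N; g < top\<rbrakk> \<Longrightarrow> covered_by N g (cover g)"
  unfolding cover_def by (rule theI') (rule ex1_cover)

lemma cover_eq:
  assumes "covered_by N g f"
  shows "cover g = f"
proof -
  have "g \<in> N" "g < top"
    using assms by (auto simp: covered_by_def intro: less_le_trans top_greatest)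
  then show ?thesis
    using ex1_cover covered_by_cover assms by blast
qed

lemma cover_in: "\<lbrakk>g \<in> N; g < top\<rbrakk> \<Longrightarrow> cover g \<in> N"
  and less_cover: "\<lbrakk>g \<in> N; g < top\<rbrakk> \<Longrightarrow> g < cover g"
  using covered_by_cover by (auto simp: covered_by_def)

text \<open>The elements above \<open>g\<close> form a chain with least element \<open>cover g\<close>.  All telescoping sums over
  upper sets rest on this step.\<close>

lemma above_iff_cover_le:
  assumes "g \<in> N" and "g < top" and "h \<in> N"
  shows "g < h \<longleftrightarrow> cover g \<le> h"
proof
  assume "g < h"
  then have "cover g \<le> h \<or> h \<le> cover g"
    using assms chain_above[of "cover g" h g] cover_in less_cover by blast
  moreover have "\<not> h < cover g"
    using covered_by_cover[of g] assms \<open>g < h\<close> by (auto simp: covered_by_def)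
  ultimately show "cover g \<le> h"
    by (auto simp: order_le_less)
next
  assume "cover g \<le> h"
  then show "g < h"
    using less_cover assms by (blast intro: less_le_trans)
qed

text \<open>Induction from the root towards the leaves.\<close>

lemma tree_induct [consumes 1, case_names top below]:
  assumes "g \<in> N" and "P top" and step: "\<And>g. \<lbrakk>g \<in> N; g < top; P (cover g)\<rbrakk> \<Longrightarrow> P g"
  shows "P g"
  using \<open>g \<in> N\<close>
proof (induction "card {g<..}" arbitrary: g rule: less_induct)
  case less
  show ?case
  proof (cases "g = top")
    case False
    then have g: "g < top"
      by (simp add: less_top)
    then have "{cover g<..} \<subset> {g<..}"
      using less_cover[OF less.prems] by fastforce
    then have "card {cover g<..} < card {g<..}"
      by (simp add: psubset_card_mono)
    then show ?thesis
      using less g step cover_in by blast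
  qed (use \<open>P top\<close> in simp)
qed

section \<open>The isomorphism\<close>

definition p_image :: "'a \<Rightarrow> real ^ ('a + 'a)" where
  "p_image g = (if g = top then 2 *\<^sub>R x_vec top else x_vec g + y_vec g - x_vec (cover g))"

definition m_image :: "'a \<Rightarrow> real ^ ('a + 'a)" where
  "m_image g = (if g = top then 0 else x_vec (cover g) + y_vec g - x_vec g)"

text \<open>The isomorphism is given on representatives: the linear map on functionals that sends
  \<open>p_fun g\<close> to \<open>p_image g\<close> and \<open>m_fun g\<close> to \<open>m_image g\<close>.  The value \<open>m_image top = 0\<close> makes it
  constant on the cosets of \<open>m_fun top\<close>.\<close>

definition to_tree :: "(real ^ ('a + 'a)) \<Rightarrow>\<^sub>L real \<Rightarrow> real ^ ('a + 'a)" where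
  "to_tree \<phi> = (\<Sum>g\<in>N. blinfun_apply \<phi> (axis (Inl g) 1) *\<^sub>R p_image g +
                      blinfun_apply \<phi> (axis (Inr g) 1) *\<^sub>R m_image g)"

text \<open>The preimage of \<open>x_vec g\<close>.  The sum runs along the path from \<open>g\<close>, included, to the root,
  excluded, and its terms map to twice the differences of consecutive vertex vectors.\<close>

definition vertex_fun :: "'a \<Rightarrow> (real ^ ('a + 'a)) \<Rightarrow>\<^sub>L real" where
  "vertex_fun g = (1/2) *\<^sub>R (p_fun top + (\<Sum>h\<in>{h \<in> N. g \<le> h \<and> h < top}. p_fun h - m_fun h))"

definition edge_fun :: "'a \<Rightarrow> (real ^ ('a + 'a)) \<Rightarrow>\<^sub>L real" where
  "edge_fun g = (1/2) *\<^sub>R (p_fun g + m_fun g)"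

definition from_tree :: "real ^ ('a + 'a) \<Rightarrow> (real ^ ('a + 'a)) \<Rightarrow>\<^sub>L real" where
  "from_tree w = (\<Sum>g\<in>N. (w $ Inl g) *\<^sub>R vertex_fun g) + (\<Sum>g\<in>N - {top}. (w $ Inr g) *\<^sub>R edge_fun g)"

lemma linear_to_tree: "linear to_tree"
  by (rule linearI)
    (simp_all add: to_tree_def plus_blinfun.rep_eq scaleR_blinfun.rep_eq sum.distrib
      scaleR_sum_right algebra_simps)

lemma linear_from_tree: "linear from_tree"
  by (rule linearI)
    (simp_all add: from_tree_def sum.distrib scaleR_sum_right algebra_simps)

lemma to_tree_p [simp]: "g \<in> N \<Longrightarrow> to_tree (p_fun g) = p_image g"
  by (simp add: to_tree_def if_distribR if_distrib[of "\<lambda>c. c *\<^sub>R _"] cong: if_cong)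

lemma to_tree_m [simp]: "g \<in> N \<Longrightarrow> to_tree (m_fun g) = m_image g"
  by (simp add: to_tree_def if_distribR if_distrib[of "\<lambda>c. c *\<^sub>R _"] cong: if_cong)

lemma from_tree_x [simp]: "g \<in> N \<Longrightarrow> from_tree (x_vec g) = vertex_fun g"
  by (simp add: from_tree_def x_vec_def axis_def if_distrib[of "\<lambda>c. c *\<^sub>R _"] cong: if_cong)

lemma from_tree_y [simp]: "\<lbrakk>g \<in> N; g \<noteq> top\<rbrakk> \<Longrightarrow> from_tree (y_vec g) = edge_fun g"
  by (simp add: from_tree_def y_vec_def axis_def if_distrib[of "\<lambda>c. c *\<^sub>R _"] cong: if_cong)

lemma vertex_fun_top: "vertex_fun top = (1/2) *\<^sub>R p_fun top"
proof -
  have "{h \<in> N. top \<le> h \<and> h < top} = {}"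
    by auto
  then show ?thesis
    by (simp only: vertex_fun_def sum.empty add_0_right)
qed

lemma vertex_fun_step:
  assumes "g \<in> N" and "g < top"
  shows "vertex_fun g = vertex_fun (cover g) + (1/2) *\<^sub>R (p_fun g - m_fun g)"
proof -
  have "{h \<in> N. g \<le> h \<and> h < top} = insert g {h \<in> N. cover g \<le> h \<and> h < top}"
    using assms above_iff_cover_le[OF assms] by (auto simp: order_le_less)
  moreover have "g \<notin> {h \<in> N. cover g \<le> h \<and> h < top}"
    using less_cover[OF assms] by auto
  ultimately show ?thesis
    by (simp add: vertex_fun_def algebra_simps)
qed

lemma F_fun_eq:
  assumes "g \<in> N" and "g < top"
  shows "F_fun N g = 2 *\<^sub>R vertex_fun (cover g) - m_fun g"
proof -
  have "{f \<in> N. g < f \<and> f < top} = {h \<in> N. cover g \<le> h \<and> h < top}"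
    using above_iff_cover_le[OF assms] by auto
  then show ?thesis
    by (simp add: F_fun_def vertex_fun_def)
qed

lemma F_fun_top: "F_fun N top = p_fun top - m_fun top"
proof -
  have "{f \<in> N. top < f \<and> f < top} = {}"
    by auto
  then show ?thesis
    by (simp only: F_fun_def sum.empty add_0_right)
qed

text \<open>The telescoping, as an induction down from the root.\<close>

lemma to_tree_vertex_fun [simp]: "g \<in> N \<Longrightarrow> to_tree (vertex_fun g) = x_vec g"
proof (induction rule: tree_induct)
  case top
  show ?case
    using top_in by (simp add: vertex_fun_top linear_scale[OF linear_to_tree] p_image_def)
next
  case (below g)
  have "2 *\<^sub>R to_tree (vertex_fun g) = 2 *\<^sub>R x_vec g"
    using below
    by (auto simp: vertex_fun_step p_image_def m_image_def
        linear_add[OF linear_to_tree] linear_scale[OF linear_to_tree]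
        linear_diff[OF linear_to_tree] scaleR_2 algebra_simps)
  then show ?case
    by simp
qed

lemma to_tree_edge_fun [simp]: "\<lbrakk>g \<in> N; g \<noteq> top\<rbrakk> \<Longrightarrow> to_tree (edge_fun g) = y_vec g"
proof -
  assume g: "g \<in> N" "g \<noteq> top"
  have "2 *\<^sub>R to_tree (edge_fun g) = 2 *\<^sub>R y_vec g"
    using g
    by (simp add: edge_fun_def p_image_def m_image_def
        linear_add[OF linear_to_tree] linear_scale[OF linear_to_tree] scaleR_2)
  then show ?thesis
    by simp
qed

lemma to_tree_F:
  assumes "g \<in> N" and "g < top"
  shows "to_tree (F_fun N g) = x_vec g + x_vec (cover g) - y_vec g"
  using assms cover_in[OF assms]
  by (simp add: F_fun_eq linear_diff[OF linear_to_tree] linear_scale[OF linear_to_tree])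
    (auto simp: m_image_def scaleR_2)

lemma from_tree_p_image:
  assumes "g \<in> N"
  shows "from_tree (p_image g) = p_fun g"
proof (cases "g = top")
  case True
  then show ?thesis
    using top_in by (simp add: p_image_def linear_scale[OF linear_from_tree] vertex_fun_top)
next
  case False
  then have "g < top"
    by (simp add: less_top)
  have "2 *\<^sub>R from_tree (p_image g) = 2 *\<^sub>R p_fun g"
    using False assms \<open>g < top\<close> cover_in[OF assms \<open>g < top\<close>]
    by (simp add: p_image_def linear_add[OF linear_from_tree] linear_diff[OF linear_from_tree]
        vertex_fun_step[OF assms] edge_fun_def scaleR_2 algebra_simps)
  then show ?thesis
    by simp
qed

lemma from_tree_m_image:
  assumes "g \<in> N"
  shows "from_tree (m_image g) = (if g = top then 0 else m_fun g)"
proof (cases "g = top")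
  case True
  then show ?thesis
    by (simp add: m_image_def linear_0[OF linear_from_tree])
next
  case False
  then have "g < top"
    by (simp add: less_top)
  have "2 *\<^sub>R from_tree (m_image g) = 2 *\<^sub>R m_fun g"
    using False assms \<open>g < top\<close> cover_in[OF assms \<open>g < top\<close>]
    by (simp add: m_image_def linear_add[OF linear_from_tree] linear_diff[OF linear_from_tree]
        vertex_fun_step[OF assms] edge_fun_def scaleR_2 algebra_simps)
  then show ?thesis
    using False by simp
qed

text \<open>The two maps are inverse to each other up to the coordinate of \<open>m_fun top\<close>, which \<open>to_tree\<close>
  discards.  This identifies the kernel of \<open>to_tree\<close>.\<close>

lemma from_tree_to_tree:
  assumes "\<phi> \<in> dual_space (N <+> N)"
  shows "from_tree (to_tree \<phi>) = \<phi> - blinfun_apply \<phi> (axis (Inr top) 1) *\<^sub>R m_fun top"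
proof -
  have "from_tree (to_tree \<phi>) = (\<Sum>g\<in>N. blinfun_apply \<phi> (axis (Inl g) 1) *\<^sub>R p_fun g +
                    blinfun_apply \<phi> (axis (Inr g) 1) *\<^sub>R (if g = top then 0 else m_fun g))"
    by (simp add: to_tree_def linear_sum[OF linear_from_tree] linear_add[OF linear_from_tree]
        linear_scale[OF linear_from_tree] from_tree_p_image from_tree_m_image)
  also have "\<dots> = (\<Sum>g\<in>N. (blinfun_apply \<phi> (axis (Inl g) 1) *\<^sub>R p_fun g +
                    blinfun_apply \<phi> (axis (Inr g) 1) *\<^sub>R m_fun g)
                  - (if g = top then blinfun_apply \<phi> (axis (Inr g) 1) *\<^sub>R m_fun g else 0))"
    by (rule sum.cong) auto
  also have "\<dots> = \<phi> - blinfun_apply \<phi> (axis (Inr top) 1) *\<^sub>R m_fun top"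
    using dual_space_expansion[OF assms] top_in by (simp add: sum_subtractf)
  finally show ?thesis .
qed

lemma vertex_fun_dual: "vertex_fun g \<in> dual_space (N <+> N)"
  unfolding vertex_fun_def
  by (intro subspace_scale subspace_add subspace_sum subspace_diff subspace_dual_space)
    (use top_in in auto)

lemma edge_fun_dual: "g \<in> N \<Longrightarrow> edge_fun g \<in> dual_space (N <+> N)"
  unfolding edge_fun_def
  by (intro subspace_scale subspace_add subspace_dual_space) auto

lemma F_fun_dual: "g \<in> N \<Longrightarrow> F_fun N g \<in> dual_space (N <+> N)"
  unfolding F_fun_def
  by (intro subspace_add subspace_sum subspace_diff subspace_dual_space) (use top_in in auto)

lemma p_image_coord:
  assumes "g \<in> N"
  shows "p_image g \<in> coord_space (N <+> (N - {top}))"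
  unfolding p_image_def
  by (auto intro!: subspace_scale subspace_add subspace_diff subspace_coord_space x_vec_coord
      y_vec_coord cover_in assms top_in simp: less_top)

lemma m_image_coord:
  assumes "g \<in> N"
  shows "m_image g \<in> coord_space (N <+> (N - {top}))"
  unfolding m_image_def
  by (auto intro!: subspace_add subspace_diff subspace_coord_space x_vec_coord
      y_vec_coord cover_in subspace_0 assms simp: less_top)

lemma to_tree_from_tree:
  assumes "w \<in> coord_space (N <+> (N - {top}))"
  shows "to_tree (from_tree w) = w"
  using coord_space_expansion[OF assms]
  by (simp add: from_tree_def linear_add[OF linear_to_tree] linear_sum[OF linear_to_tree]
      linear_scale[OF linear_to_tree])

lemma to_tree_image: "to_tree ` dual_space (N <+> N) = coord_space (N <+> (N - {top}))"
proof (intro equalityI subsetI)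
  fix w assume w: "w \<in> coord_space (N <+> (N - {top}))"
  have "from_tree w \<in> dual_space (N <+> N)"
    unfolding from_tree_def
    by (intro subspace_scale subspace_add subspace_sum subspace_dual_space)
      (auto simp: vertex_fun_dual edge_fun_dual)
  then show "w \<in> to_tree ` dual_space (N <+> N)"
    using to_tree_from_tree[OF w] by (metis image_eqI)
next
  fix w assume "w \<in> to_tree ` dual_space (N <+> N)"
  then show "w \<in> coord_space (N <+> (N - {top}))"
    by (auto simp: to_tree_def intro!: subspace_sum subspace_add subspace_scale
        subspace_coord_space p_image_coord m_image_coord)
qed

lemma to_tree_kernel: "span {m_fun top} = {\<phi> \<in> dual_space (N <+> N). to_tree \<phi> = 0}"
proof (intro equalityI subsetI)
  fix \<phi> assume "\<phi> \<in> span {m_fun top :: (real ^ ('a + 'a)) \<Rightarrow>\<^sub>L real}"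
  then obtain c where "\<phi> = c *\<^sub>R m_fun top"
    by (auto simp: span_singleton)
  then show "\<phi> \<in> {\<phi> \<in> dual_space (N <+> N). to_tree \<phi> = 0}"
    using top_in
    by (auto simp: linear_scale[OF linear_to_tree] m_image_def
        intro: subspace_scale subspace_dual_space)
next
  fix \<phi> assume "\<phi> \<in> {\<phi> \<in> dual_space (N <+> N). to_tree \<phi> = 0}"
  then have "\<phi> = blinfun_apply \<phi> (axis (Inr top) 1) *\<^sub>R m_fun top"
    using from_tree_to_tree[of \<phi>] by (simp add: linear_0[OF linear_from_tree])
  then show "\<phi> \<in> span {m_fun top}"
    by (metis span_base span_scale singletonI)
qed

section \<open>The cone and its dual\<close>

text \<open>At the point with all \<open>p\<close>- and \<open>m\<close>-coordinates below the root equal to \<open>1\<close>, the sum in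
  \<open>F_fun N g\<close> cancels.  With root coordinate \<open>p = 2\<close> every inequality is then strict, apart from
  \<open>m_fun top \<ge> 0\<close>, which holds with equality on the whole hyperplane.  So the cone contains a
  nonempty relatively open subset of the hyperplane.\<close>

lemma aff_dim_cone_U: "aff_dim (cone_U N) = int (dim (hyperplane_N N))"
proof -
  define interior_cone where "interior_cone = (\<Inter>g\<in>N. {v. 0 < blinfun_apply (p_fun g) v} \<inter>
      {v. 0 < blinfun_apply (F_fun N g) v} \<inter>
      (if g = top then UNIV else {v. 0 < blinfun_apply (m_fun g) v}))"
  define v :: "real ^ ('a + 'a)" where
    "v = (\<chi> i. case i of Inl g \<Rightarrow> (if g = top then 2 else if g \<in> N then 1 else 0)
                    | Inr g \<Rightarrow> (if g \<in> N \<and> g \<noteq> top then 1 else 0))"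
  have "open interior_cone"
    unfolding interior_cone_def
    by (auto intro!: open_INT open_Int open_Collect_less continuous_intros)
  moreover have "v \<in> hyperplane_N N"
    using top_in by (auto simp: v_def hyperplane_N_def coord_space_def m_fun_apply split: sum.split)
  moreover have "v \<in> interior_cone"
  proof -
    have "(\<Sum>f\<in>{f \<in> N. g < f \<and> f < top}. v $ Inl f - v $ Inr f) = 0" for g
      by (rule sum.neutral) (auto simp: v_def)
    then show ?thesis
      by (auto simp: interior_cone_def F_fun_apply p_fun_apply m_fun_apply) (auto simp: v_def)
  qed
  ultimately have "aff_dim (hyperplane_N N \<inter> interior_cone) = aff_dim (hyperplane_N N)"
    by (intro aff_dim_convex_Int_open subspace_imp_convex subspace_hyperplane_N) auto
  moreover have "hyperplane_N N \<inter> interior_cone \<subseteq> cone_U N"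
    by (fastforce simp: cone_U_def interior_cone_def hyperplane_N_def less_imp_le split: if_splits)
  then have "aff_dim (hyperplane_N N \<inter> interior_cone) \<le> aff_dim (cone_U N)"
    by (rule aff_dim_subset)
  moreover have "aff_dim (cone_U N) \<le> aff_dim (hyperplane_N N)"
    by (rule aff_dim_subset) (auto simp: cone_U_def)
  ultimately show ?thesis
    by (simp add: aff_dim_subspace[OF subspace_hyperplane_N])
qed

definition edge_vectors :: "(real ^ ('a + 'a)) set" where
  "edge_vectors = (\<Union>(f, g) \<in> {(f, g). covered_by N f g}.
     {x_vec f + x_vec g - y_vec f, x_vec f - x_vec g + y_vec f, - x_vec f + x_vec g + y_vec f})"

text \<open>The three vectors attached to an edge are the images of the three functionals indexed by its
  lower endpoint.\<close>

lemma edge_vectors_eq: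
  "edge_vectors = (\<Union>g\<in>N - {top}. {to_tree (F_fun N g), p_image g, m_image g})"
proof -
  have "{(f, g). covered_by N f g} = (\<lambda>g. (g, cover g)) ` (N - {top})"
  proof (intro equalityI subsetI)
    fix e assume "e \<in> {(f, g). covered_by N f g}"
    then obtain f g where e: "e = (f, g)" "covered_by N f g"
      by auto
    then have "f \<in> N" "f \<noteq> top"
      by (auto simp: covered_by_def less_top[symmetric] dest: less_le_trans)
    then show "e \<in> (\<lambda>g. (g, cover g)) ` (N - {top})"
      using e cover_eq by blast
  qed (auto simp: less_top intro: covered_by_cover)
  then have "edge_vectors = (\<Union>g\<in>N - {top}. {x_vec g + x_vec (cover g) - y_vec g,
      x_vec g - x_vec (cover g) + y_vec g, - x_vec g + x_vec (cover g) + y_vec g})"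
    by (simp add: edge_vectors_def)
  also have "\<dots> = (\<Union>g\<in>N - {top}. {to_tree (F_fun N g), p_image g, m_image g})"
    by (intro SUP_cong refl)
      (auto simp: to_tree_F less_top[symmetric] p_image_def m_image_def algebra_simps)
  finally show ?thesis .
qed

text \<open>The adjoint of \<open>to_tree\<close> at a vector \<open>a\<close>: it turns a linear form on the space of the tree into a
  point of the hyperplane, so that the cone can be tested against the hypothesis of Farkas'
  lemma.\<close>

lemma to_tree_adjoint:
  obtains v where "v \<in> hyperplane_N N"
    and "\<And>\<phi>. \<phi> \<in> dual_space (N <+> N) \<Longrightarrow> blinfun_apply \<phi> v = a \<bullet> to_tree \<phi>"
proof -
  define v :: "real ^ ('a + 'a)" where
    "v = (\<chi> i. case i of Inl g \<Rightarrow> (if g \<in> N then a \<bullet> p_image g else 0)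
                    | Inr g \<Rightarrow> (if g \<in> N then a \<bullet> m_image g else 0))"
  show thesis
  proof (rule that)
    show "v \<in> hyperplane_N N"
      by (auto simp: v_def hyperplane_N_def coord_space_def m_fun_apply m_image_def
          split: sum.split)
    fix \<phi> :: "(real ^ ('a + 'a)) \<Rightarrow>\<^sub>L real"
    assume "\<phi> \<in> dual_space (N <+> N)"
    then have "blinfun_apply \<phi> v = blinfun_apply (\<Sum>g\<in>N. blinfun_apply \<phi> (axis (Inl g) 1) *\<^sub>R p_fun g +
                    blinfun_apply \<phi> (axis (Inr g) 1) *\<^sub>R m_fun g) v"
      by (rule arg_cong[OF dual_space_expansion, where f = "\<lambda>\<psi>. blinfun_apply \<psi> v"])
    also have "\<dots> = a \<bullet> to_tree \<phi>"
      by (simp add: to_tree_def blinfun.sum_left blinfun.add_left blinfun.scaleR_left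
          p_fun_apply m_fun_apply inner_sum_right inner_add_right) (simp add: v_def)
    finally show "blinfun_apply \<phi> v = a \<bullet> to_tree \<phi>" .
  qed
qed

text \<open>One inclusion is Farkas' lemma: a form \<open>a\<close> that is nonnegative on the generators has its
  adjoint point in \<open>cone_U N\<close>, where every functional of the dual cone is nonnegative.  The other
  holds because the generators are images of functionals that define \<open>cone_U N\<close>.\<close>

lemma to_tree_dual_cone:
  "to_tree ` {\<phi> \<in> dual_space (N <+> N). \<forall>v\<in>cone_U N. 0 \<le> blinfun_apply \<phi> v} =
     convex_cone hull (insert (2 *\<^sub>R x_vec top) edge_vectors)"
    (is "to_tree ` ?D = convex_cone hull ?A")
proof
  have "finite ?A"
    by (simp add: edge_vectors_eq)
  show "to_tree ` ?D \<subseteq> convex_cone hull ?A"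
  proof (rule image_subsetI, rule farkas[OF \<open>finite ?A\<close>])
    fix \<phi> a assume \<phi>: "\<phi> \<in> ?D" and a: "\<And>x. x \<in> ?A \<Longrightarrow> 0 \<le> a \<bullet> x"
    obtain v where v: "v \<in> hyperplane_N N"
      "\<And>\<phi>. \<phi> \<in> dual_space (N <+> N) \<Longrightarrow> blinfun_apply \<phi> v = a \<bullet> to_tree \<phi>"
      using to_tree_adjoint by blast
    have "0 \<le> a \<bullet> p_image g \<and> 0 \<le> a \<bullet> m_image g \<and> 0 \<le> a \<bullet> to_tree (F_fun N g)"
      if "g \<in> N" for g
    proof (cases "g = top")
      case True
      then show ?thesis
        using a[of "2 *\<^sub>R x_vec top"] top_in
        by (simp add: F_fun_top p_image_def m_image_def linear_diff[OF linear_to_tree])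
    next
      case False
      then show ?thesis
        using that a by (auto simp: edge_vectors_eq)
    qed
    then have "v \<in> cone_U N"
      using v by (simp add: cone_U_def F_fun_dual)
    then show "0 \<le> a \<bullet> to_tree \<phi>"
      using \<phi> v by auto
  qed
  have "convex_cone ?D"
    unfolding convex_cone_iff
    using subspace_dual_space[of "N <+> N"]
    by (auto simp: blinfun.add_left blinfun.scaleR_left subspace_def)
  then have "convex_cone (to_tree ` ?D)"
    using linear_to_tree by (simp add: convex_cone_linear_image)
  moreover have "?A \<subseteq> to_tree ` ?D"
  proof -
    have "p_fun g \<in> ?D" "m_fun g \<in> ?D" "F_fun N g \<in> ?D" if "g \<in> N" for g
      using that by (auto simp: cone_U_def F_fun_dual)
    then have img: "to_tree (p_fun g) \<in> to_tree ` ?D" "to_tree (m_fun g) \<in> to_tree ` ?D"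
      "to_tree (F_fun N g) \<in> to_tree ` ?D" if "g \<in> N" for g
      using that by blast+
    have "p_image g \<in> to_tree ` ?D" "m_image g \<in> to_tree ` ?D" if "g \<in> N" for g
      using img(1,2)[OF that] by (simp_all only: to_tree_p[OF that] to_tree_m[OF that])
    moreover have "2 *\<^sub>R x_vec top = p_image top"
      by (simp add: p_image_def)
    ultimately show ?thesis
      using img(3) top_in unfolding edge_vectors_eq by (auto simp del: image_iff)
  qed
  ultimately show "convex_cone hull ?A \<subseteq> to_tree ` ?D"
    by (simp add: hull_minimal)
qed

lemma generators_cone_trivial:
  assumes "N = {top}"
  shows "convex_cone hull (insert (2 *\<^sub>R x_vec top) edge_vectors) = cone hull {x_vec top}"
proof -
  have "edge_vectors = {}"
    unfolding edge_vectors_eq using assms by blast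
  moreover have "cone hull {2 *\<^sub>R x_vec top} = cone hull {x_vec top :: real ^ ('a + 'a)}"
  proof (intro equalityI hull_minimal)
    show "{2 *\<^sub>R x_vec top} \<subseteq> cone hull {x_vec top :: real ^ ('a + 'a)}"
      by (simp add: mem_cone_hull)
    have "(1/2) *\<^sub>R (2 *\<^sub>R x_vec top) \<in> cone hull {2 *\<^sub>R x_vec top :: real ^ ('a + 'a)}"
      by (rule mem_cone_hull) auto
    then show "{x_vec top} \<subseteq> cone hull {2 *\<^sub>R x_vec top :: real ^ ('a + 'a)}"
      by simp
  qed (rule cone_cone_hull)+
  ultimately show ?thesis
    by (simp add: convex_cone_hull_eq_cone_hull)
qed

text \<open>For an element \<open>g\<close> maximal below the root, the vertices \<open>x_vec g + x_vec top - y_vec g\<close> and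
  \<open>x_vec top + y_vec g - x_vec g\<close> add up to the additional generator \<open>2 x_vec top\<close>.\<close>

lemma generators_cone:
  assumes "N \<noteq> {top}"
  shows "convex_cone hull (insert (2 *\<^sub>R x_vec top) edge_vectors) =
    cone hull (cosmological_polytope N)"
proof -
  obtain g where g: "g \<in> N - {top}" "\<And>h. h \<in> N - {top} \<Longrightarrow> g \<le> h \<Longrightarrow> g = h"
    using finite_has_maximal[of "N - {top}"] assms top_in by auto
  then have "g < top"
    by (simp add: less_top)
  then have "cover g = top"
    using g cover_in[of g] less_cover[of g] by force
  then have "2 *\<^sub>R x_vec top = to_tree (F_fun N g) + m_image g"
    using g \<open>g < top\<close> by (simp add: to_tree_F m_image_def scaleR_2)
  moreover have "to_tree (F_fun N g) \<in> edge_vectors" "m_image g \<in> edge_vectors"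
    using g by (auto simp: edge_vectors_eq)
  ultimately have "2 *\<^sub>R x_vec top \<in> convex_cone hull edge_vectors"
    by (simp add: convex_cone_hull_add hull_inc)
  then have "convex_cone hull (insert (2 *\<^sub>R x_vec top) edge_vectors) =
      convex_cone hull edge_vectors"
    by (rule hull_redundant)
  also have "\<dots> = cone hull (convex hull edge_vectors)"
    using g by (intro convex_cone_hull_eq_cone_hull) (auto simp: edge_vectors_eq)
  finally show ?thesis
    by (simp add: cosmological_polytope_def edge_vectors_def)
qed

end

section \<open>Maximal nested sets are trees\<close>

text \<open>Adding \<open>top\<close> to a nested set keeps it nested because \<open>top\<close> is comparable to everything, so a
  maximal nested set contains it.  Two incomparable elements above a common \<open>h\<close> would have meet
  \<open>bot\<close> by nestability, although \<open>bot < h\<close> is below both.\<close>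

lemma nested_tree_of_maximal_nested:
  assumes G: "nestable G" and N: "maximal_nested G N"
  shows "nested_tree N"
proof
  have nested: "nested G N" and max: "\<And>B. nested G B \<Longrightarrow> N \<subseteq> B \<Longrightarrow> B = N"
    using N by (auto simp: maximal_nested_def facet_def nested_complex_def)
  have "nested G (insert top N)"
    unfolding nested_def
  proof (intro conjI allI impI)
    show "insert top N \<subseteq> G"
      using nested G by (auto simp: nested_def nestable_def)
    fix A assume A: "A \<subseteq> insert top N" "2 \<le> card A \<and> pairwise incomparable A"
    have "top \<notin> A"
    proof
      assume "top \<in> A"
      then have "A \<subseteq> {top}"
        using A by (fastforce simp: pairwise_def incomparable_def)
      then have "card A \<le> 1"
        using card_mono[of "{top}" A] by simp
      then show False
        using A by simp
    qed
    then show "Sup_fin A \<notin> G"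
      using A nested by (auto simp: nested_def)
  qed
  then show "top \<in> N"
    using max by blast
  show "f \<le> g \<or> g \<le> f" if fgh: "f \<in> N" "g \<in> N" "h \<in> N" "h < f" "h < g" for f g h
  proof (rule ccontr)
    assume "\<not> ?thesis"
    then have inc: "incomparable f g" "incomparable g f" "f \<noteq> g"
      by (auto simp: incomparable_def)
    then have "{f, g} \<subseteq> N \<and> 2 \<le> card {f, g} \<and> pairwise incomparable {f, g}"
      using fgh by (simp add: pairwise_insert)
    then have "Sup_fin {f, g} \<notin> G"
      using nested unfolding nested_def by blast
    then have "sup f g \<notin> G"
      by simp
    moreover have "f \<in> G" "g \<in> G"
      using nested fgh by (auto simp: nested_def)
    ultimately have "inf f g = bot"
      using G inc(1) unfolding nestable_def by simp
    then have "h \<le> bot"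
      using fgh by (metis le_inf_iff less_imp_le)
    moreover have "bot < h"
      using G nested fgh by (auto simp: nestable_def nested_def)
    ultimately show False
      by auto
  qed
qed

theorem proposition3p16:
  fixes G N :: "'a::{finite, bounded_lattice} set"
  assumes "nestoid G" and "maximal_nested G N"
  shows "aff_dim (cone_U N) = int (dim (hyperplane_N N)) \<and>
    (\<forall>g\<in>N. g < top \<longrightarrow> (\<exists>!f. covered_by N g f)) \<and>
    (\<exists>\<Psi>. linear_iso_quotient
            (dual_space (N <+> N)) (span {m_fun top}) (coord_space (N <+> (N - {top}))) \<Psi> \<and>
          \<Psi> (coset (span {m_fun top}) (p_fun top)) = 2 *\<^sub>R x_vec top \<and>
          (\<forall>g f. covered_by N g f \<longrightarrow>
             \<Psi> (coset (span {m_fun top}) (p_fun g)) = x_vec g + y_vec g - x_vec f \<and>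
             \<Psi> (coset (span {m_fun top}) (m_fun g)) = x_vec f + y_vec g - x_vec g) \<and>
          (N \<noteq> {top} \<longrightarrow> \<Psi> ` dual_cone_U N = cone hull (cosmological_polytope N)) \<and>
          (N = {top} \<longrightarrow> \<Psi> ` dual_cone_U N = cone hull {x_vec top}))"
proof -
  interpret nested_tree N
    using assms by (auto simp: nestoid_def intro: nested_tree_of_maximal_nested)
  obtain \<Psi> where iso: "linear_iso_quotient (dual_space (N <+> N)) (span {m_fun top})
        (coord_space (N <+> (N - {top}))) \<Psi>"
    and \<Psi>: "\<And>\<phi>. \<phi> \<in> dual_space (N <+> N) \<Longrightarrow> \<Psi> (coset (span {m_fun top}) \<phi>) = to_tree \<phi>"
    using first_isomorphism[OF linear_to_tree subspace_dual_space to_tree_kernel to_tree_image]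
    by blast
  have "\<Psi> (coset (span {m_fun top}) (p_fun g)) = x_vec g + y_vec g - x_vec f \<and>
      \<Psi> (coset (span {m_fun top}) (m_fun g)) = x_vec f + y_vec g - x_vec g"
    if "covered_by N g f" for g f
  proof -
    have "g \<in> N" "g \<noteq> top"
      using that by (auto simp: covered_by_def less_top[symmetric] dest: less_le_trans)
    then show ?thesis
      using cover_eq[OF that] by (simp add: \<Psi> p_image_def m_image_def)
  qed
  moreover have "\<Psi> (coset (span {m_fun top}) (p_fun top)) = 2 *\<^sub>R x_vec top"
    using top_in by (simp add: \<Psi> p_image_def)
  moreover have "\<Psi> ` dual_cone_U N =
      to_tree ` {\<phi> \<in> dual_space (N <+> N). \<forall>v\<in>cone_U N. 0 \<le> blinfun_apply \<phi> v}"
    by (force simp: dual_cone_U_def \<Psi>)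
  then have "\<Psi> ` dual_cone_U N = convex_cone hull (insert (2 *\<^sub>R x_vec top) edge_vectors)"
    by (simp add: to_tree_dual_cone)
  moreover have "\<forall>g\<in>N. g < top \<longrightarrow> (\<exists>!f. covered_by N g f)"
    using ex1_cover by blast
  ultimately show ?thesis
    using aff_dim_cone_U iso generators_cone generators_cone_trivial
    by (intro conjI exI[of _ \<Psi>]) metis+
qed

end
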